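(* Let $(X_i)_{i\in\mathbb Z}$ be a strictly stationary sequence of random variables, defined on a probability space $(\Omega,\mathcal T,\mathbb P)$, with values in some Polish space $E$. Let $(\alpha_{\infty,1}(n))_{n\ge0}$ be its associated sequence of strong mixing coefficients, and denote by $\mu$ the law of $X_0$. Let $(A_k)_{k>0}$ be a sequence of Borel sets in $E$ satisfying $\sum_{k>0}\mu(A_k)=+\infty$, and set $B_k=\{X_k\in A_k\}$ for any positive $k$. Assume that there exist $n_0>0$, $C>0$, $\delta>0$ and a non-increasing sequence $(\alpha_*(n))_{n\ge0}$ such that for all $n\ge n_0$, $$\alpha_{\infty,1}(n)\le C\alpha_*(n)\quad\text{and}\quad\alpha_*(2n)\le(1-\delta)\alpha_*(n).$$ Suppose in addition that $(\mu(A_n))_{n\ge1}$ is a non-increasing sequence, that $$\frac{\mu(A_n)}{\alpha_*(n)}\to\infty\ \text{ as } n\to\infty,\quad\text{and that}\quad\sum_{n\ge1}\frac{\mu(A_n)}{\alpha_*^{-1}(\mu(A_n))}=\infty.$$ Then $(B_k)_{k>0}$ is a Borel-Cantelli sequence, i.e. $\mathbb P(\limsup_k B_k)=1$, or equivalently $\sum_{k>0}\mathbf 1_{B_k}=\infty$ almost surely.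
   Context: For $\sigma$-fields $\mathcal A,\mathcal B\subset\mathcal T$, $\alpha(\mathcal A,\mathcal B)=\sup\{|\mathbb P(A\cap B)-\mathbb P(A)\mathbb P(B)|:A\in\mathcal A,\ B\in\mathcal B\}$ (equivalently $2\alpha(\mathcal A,\mathcal B)=\sup_{B\in\mathcal B}\mathbb E|\mathbb P(B\mid\mathcal A)-\mathbb P(B)|$). With $\mathcal F_m=\sigma(X_k:k\le m)$, the strong mixing coefficients are $\alpha_{\infty,1}(n)=\alpha(\mathcal F_{-n},\sigma(X_0))$, which are non-increasing in $n$. For any non-increasing sequence $(v_n)_{n\in\mathbb N}$ of reals ($\mathbb N=\{0,1,2,\dots\}$), the function $v^{-1}$ is defined by $v^{-1}(u)=\inf\{n\in\mathbb N:v_n\le u\}=\sum_{n\ge0}\mathbf 1_{\{u<v_n\}}$; $\alpha_*^{-1}$ is the inverse in this sense of the sequence $(\alpha_*(n))_{n\ge0}$. *)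

theory Defs
  imports "HOL-Probability.Probability"
begin

definition alpha_coeff :: "'w measure \<Rightarrow> 'w set set \<Rightarrow> 'w set set \<Rightarrow> real" where
  "alpha_coeff M \<A> \<B> =
     (SUP (A, B)\<in>\<A> \<times> \<B>. \<bar>measure M (A \<inter> B) - measure M A * measure M B\<bar>)"

definition sigma_gen :: "'w measure \<Rightarrow> ('i \<Rightarrow> 'w \<Rightarrow> 'e::topological_space) \<Rightarrow> 'i set \<Rightarrow> 'w set set" where
  "sigma_gen M X I =
     sigma_sets (space M) (\<Union>i\<in>I. {X i -` S \<inter> space M | S. S \<in> sets borel})"

definition alpha_inf_1 :: "'w measure \<Rightarrow> (int \<Rightarrow> 'w \<Rightarrow> 'e::topological_space) \<Rightarrow> nat \<Rightarrow> real" where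
  "alpha_inf_1 M X n = alpha_coeff M (sigma_gen M X {..- int n}) (sigma_gen M X {0})"

definition strictly_stationary :: "'w measure \<Rightarrow> (int \<Rightarrow> 'w \<Rightarrow> 'e::topological_space) \<Rightarrow> bool" where
  "strictly_stationary M X \<longleftrightarrow>
     (\<forall>i. X i \<in> measurable M borel) \<and>
     (\<forall>h. distr M (\<Pi>\<^sub>M i\<in>UNIV. borel) (\<lambda>\<omega> i. X (i + h) \<omega>) =
          distr M (\<Pi>\<^sub>M i\<in>UNIV. borel) (\<lambda>\<omega> i. X i \<omega>))"

text \<open>Extended-real valued, so that the infimum over the empty set is \<open>\<infinity>\<close>.\<close>

definition seq_inverse :: "(nat \<Rightarrow> real) \<Rightarrow> real \<Rightarrow> ereal" where
  "seq_inverse v u = (INF n\<in>{n. v n \<le> u}. ereal (real n))"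

lemma seq_inverse_eq_suminf:
  assumes "antimono v"
  shows "seq_inverse v u = (\<Sum>n. if u < v n then 1 else 0)"
proof (cases "\<exists>n. v n \<le> u")
  case True
  define N where "N = (LEAST n. v n \<le> u)"
  have N: "v N \<le> u" unfolding N_def using True by (metis LeastI)
  have less: "u < v n \<longleftrightarrow> n < N" for n
    using N not_less_Least[of n "\<lambda>n. v n \<le> u"] antimonoD[OF assms, of N n]
    unfolding N_def[symmetric] by (metis leD leI order_trans)
  have "seq_inverse v u = ereal (real N)"
    unfolding seq_inverse_def
    by (rule INF_eqI) (use N less in \<open>auto simp: not_less[symmetric]\<close>)
  moreover have "(\<Sum>n. if u < v n then 1 else 0 :: ereal) = (\<Sum>n<N. if u < v n then 1 else 0)"
    by (rule suminf_finite) (auto simp: less)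
  moreover have "(\<Sum>n<N. if u < v n then 1 else 0 :: ereal) = (\<Sum>n<N. ereal 1)"
    by (rule sum.cong) (auto simp: less)
  ultimately show ?thesis by (simp only: sum_ereal) simp
next
  case False
  then have less: "u < v n" for n by (simp add: not_le)
  have "(\<Sum>n::nat. 1::ereal) = \<infinity>"
  proof (rule ereal_top)
    fix B
    obtain n :: nat where "B \<le> real n" using real_arch_simple by blast
    also have "ereal (real n) = (\<Sum>i<n. ereal 1)" by (simp only: sum_ereal) simp
    also have "\<dots> \<le> (\<Sum>n::nat. 1::ereal)"
      unfolding one_ereal_def by (rule sum_le_suminf) (auto intro: summable_ereal_pos)
    finally show "ereal B \<le> (\<Sum>n::nat. 1::ereal)" by simp
  qed
  with False less show ?thesis by (simp add: seq_inverse_def top_ereal_def)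
qed

text \<open>The sequence is indexed by \<open>k > 0\<close>; the limit superior does not depend on \<open>B 0\<close>.\<close>

definition borel_cantelli_seq :: "'w measure \<Rightarrow> (nat \<Rightarrow> 'w set) \<Rightarrow> bool" where
  "borel_cantelli_seq M B \<longleftrightarrow> measure M (limsup B) = 1"

lemma borel_cantelli_seq_iff_AE:
  assumes "prob_space M" "\<And>k. B k \<in> sets M"
  shows "borel_cantelli_seq M B \<longleftrightarrow> (AE \<omega> in M. \<exists>\<^sub>\<infinity>k. \<omega> \<in> B k)"
proof -
  interpret prob_space M by fact
  have L: "limsup B = {\<omega>. \<exists>\<^sub>\<infinity>k. \<omega> \<in> B k}"
    by (auto simp: limsup_INF_SUP INFM_nat_le)
  have "limsup B \<in> sets M"
    using assms(2) by (auto simp: limsup_INF_SUP)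
  from prob_eq_1[OF this] show ?thesis
    by (simp add: borel_cantelli_seq_def L)
qed

end

theory Submission
  imports Defs
begin

text \<open>
  Let \<open>p n\<close> be the probability of the \<open>n\<close>-th event and fix \<open>\<epsilon> > 0\<close>. If \<open>S\<close> is a set of indices such that
  consecutive elements \<open>k < n\<close> of \<open>S\<close> have a gap \<open>n - k\<close> at which the mixing coefficient is at most
  \<open>\<epsilon> * p n\<close>, then the probability \<open>d n\<close> that no event with index in \<open>S\<close> up to \<open>n\<close> occurs satisfies
  \<open>d n - \<epsilon> \<le> (1 - p n) * (d (n - 1) - \<epsilon>)\<close> for \<open>n \<in> S\<close>, so \<open>d n \<le> \<epsilon> + exp (- (\<Sum>k\<in>S. p k))\<close>, the sum
  being over \<open>k \<le> n\<close>. It remains to find such an \<open>S\<close> with \<open>(\<Sum>k\<in>S. p k) = \<infinity>\<close>. By the doubling condition,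
  a constant multiple of \<open>\<alpha>\<^sub>*\<^sup>-\<^sup>1(p n)\<close> is a sufficient gap. Spacing \<open>S\<close> equally within each dyadic block
  captures the divergent series \<open>p n / \<alpha>\<^sub>*\<^sup>-\<^sup>1(p n)\<close> by Cauchy condensation, except for the blocks that are
  shorter than the required gap; there \<open>p\<close> is bounded by a value of \<open>\<alpha>\<^sub>*\<close> which decays geometrically in
  the block index, so these blocks contribute only a convergent series.
\<close>

section \<open>Stationarity and the mixing inequality for finitely many past events\<close>

lemma strictly_stationary_measure_shift:
  assumes "strictly_stationary M X" and T: "T \<in> sets (\<Pi>\<^sub>M i\<in>UNIV. borel)"
  shows "measure M {\<omega> \<in> space M. (\<lambda>i. X (i + h) \<omega>) \<in> T} = measure M {\<omega> \<in> space M. (\<lambda>i. X i \<omega>) \<in> T}"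
proof -
  have X: "X i \<in> measurable M borel" for i
    using assms(1) by (auto simp: strictly_stationary_def)
  have eq: "distr M (\<Pi>\<^sub>M i\<in>UNIV. borel) (\<lambda>\<omega> i. X (i + h) \<omega>)
      = distr M (\<Pi>\<^sub>M i\<in>UNIV. borel) (\<lambda>\<omega> i. X i \<omega>)"
    using assms(1) by (auto simp: strictly_stationary_def)
  have m: "(\<lambda>\<omega> i. X (i + k) \<omega>) \<in> measurable M (\<Pi>\<^sub>M i\<in>UNIV. borel)" for k
    by (rule measurable_PiM_single') (auto simp: X)
  show ?thesis
    using arg_cong[OF eq, of "\<lambda>N. measure N T"] measure_distr[OF m T, of h] measure_distr[OF m T, of 0]
    by (simp add: vimage_def Int_def conj_commute)
qed

lemma (in prob_space) alpha_coeff_upper: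
  assumes "A \<in> \<A>" "B \<in> \<B>"
  shows "\<bar>prob (A \<inter> B) - prob A * prob B\<bar> \<le> alpha_coeff M \<A> \<B>"
proof -
  \<comment> \<open>A supremum in the reals bounds its members only if the set is bounded above;
    here 1 is a bound.\<close>
  have "\<bar>prob (A \<inter> B) - prob A * prob B\<bar> \<le> 1" for A B
    using prob_le_1[of "A \<inter> B"] mult_le_one[OF prob_le_1[of A] measure_nonneg prob_le_1[of B]]
      measure_nonneg[of M "A \<inter> B"] mult_nonneg_nonneg[OF measure_nonneg[of M A] measure_nonneg[of M B]]
    by linarith
  then have "bdd_above ((\<lambda>(A, B). \<bar>prob (A \<inter> B) - prob A * prob B\<bar>) ` (\<A> \<times> \<B>))"
    by (intro bdd_aboveI2[where M = 1]) auto
  from cSUP_upper[OF _ this, of "(A, B)"] assms show ?thesis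
    by (simp add: alpha_coeff_def)
qed

lemma sigma_gen_single:
  assumes "i \<in> I" "S \<in> sets borel"
  shows "{\<omega> \<in> space M. X i \<omega> \<in> S} \<in> sigma_gen M X I"
  unfolding sigma_gen_def using assms
  by (intro sigma_sets.Basic) (auto simp: vimage_def Int_def conj_commute)

lemma sigma_gen_sigma_algebra: "sigma_algebra (space M) (sigma_gen M X I)"
  unfolding sigma_gen_def by (rule sigma_algebra_sigma_sets) auto

text \<open>The mixing coefficient is anchored at time 0. Translating all times by
  \<open>- n\<close> carries the last event into the sigma-field of \<open>X 0\<close> and the
  earlier ones to times at most \<open>- m\<close>, and stationarity leaves all three probabilities
  unchanged.\<close>

lemma (in prob_space) alpha_inf_1_past_future:
  fixes X :: "int \<Rightarrow> 'a \<Rightarrow> 'e::topological_space" and L :: "int set"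
  assumes st: "strictly_stationary M X"
    and L: "finite L" "\<And>l. l \<in> L \<Longrightarrow> l + int m \<le> n" "\<And>l. l \<in> L \<Longrightarrow> A l \<in> sets borel"
    and A: "A' \<in> sets borel"
  shows "\<bar>prob {\<omega> \<in> space M. (\<forall>l\<in>L. X l \<omega> \<in> A l) \<and> X n \<omega> \<in> A'} -
    prob {\<omega> \<in> space M. \<forall>l\<in>L. X l \<omega> \<in> A l} * prob {\<omega> \<in> space M. X n \<omega> \<in> A'}\<bar> \<le> alpha_inf_1 M X m"
proof -
  define P where "P = (\<Pi>\<^sub>M i\<in>(UNIV::int set). (borel :: 'e measure))"
  have sp: "space P = UNIV" by (simp add: P_def space_PiM)
  have c[measurable]: "(\<lambda>x. x i) \<in> measurable P borel" for i
    unfolding P_def by (rule measurable_component_singleton) simp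
  note [measurable] = A
  have "{x \<in> space P. x l \<in> A l} \<in> sets P" if "l \<in> L" for l
    using L(3)[OF that] by measurable
  then have 1: "{x \<in> space P. \<forall>l\<in>L. x l \<in> A l} \<in> sets P"
    using L(1) by (intro sets.sets_Collect_finite_All)
  have 2: "{x \<in> space P. x n \<in> A'} \<in> sets P"
    by measurable
  have 3: "{x \<in> space P. (\<forall>l\<in>L. x l \<in> A l) \<and> x n \<in> A'} \<in> sets P"
    using sets.Int[OF 1 2] by (simp add: Int_def sp)
  note shift = strictly_stationary_measure_shift[OF st, where h = "- n", folded P_def]
  have D: "{\<omega> \<in> space M. \<forall>l\<in>L. X (l - n) \<omega> \<in> A l} \<in> sigma_gen M X {..- int m}"
  proof -
    interpret sigma_algebra "space M" "sigma_gen M X {..- int m}"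
      by (rule sigma_gen_sigma_algebra)
    show ?thesis
      using L by (intro sets_Collect_finite_All sigma_gen_single) (auto simp: algebra_simps)
  qed
  have E: "{\<omega> \<in> space M. X 0 \<omega> \<in> A'} \<in> sigma_gen M X {0}"
    using A by (intro sigma_gen_single) auto
  have "{\<omega> \<in> space M. \<forall>l\<in>L. X (l - n) \<omega> \<in> A l} \<inter> {\<omega> \<in> space M. X 0 \<omega> \<in> A'}
     = {\<omega> \<in> space M. (\<forall>l\<in>L. X (l - n) \<omega> \<in> A l) \<and> X 0 \<omega> \<in> A'}"
    by auto
  with alpha_coeff_upper[OF D E] shift[OF 1] shift[OF 2] shift[OF 3] show ?thesis
    by (simp add: alpha_inf_1_def sp)
qed

section \<open>Selection of a sparse index set with divergent sum\<close>

text \<open>Since \<open>g\<close> is monotone, \<open>g (2 ^ Suc j)\<close> is a valid gap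
  throughout the block from \<open>2 ^ j\<close> to \<open>2 ^ Suc j\<close>. If it fits into the
  block, rounding the number of selected points down costs at most a factor 2; the blocks where it
  does not fit are those counted in \<open>bad\<close>.\<close>

lemma sparse_index_set:
  fixes p :: "nat \<Rightarrow> real" and g :: "nat \<Rightarrow> nat"
  assumes p: "antimono p" "\<And>n. 0 \<le> p n"
    and g: "mono g" "\<And>n. 0 < g n"
    and bad: "summable (\<lambda>j. if 2 ^ j < g (2 ^ Suc j) then p (2 ^ Suc j) else 0)"
    and div: "\<not> summable (\<lambda>n. p n / real (g n))"
  obtains S where "\<And>k. k \<in> S \<Longrightarrow> 0 < k"
    and "\<And>k n. k \<in> S \<Longrightarrow> n \<in> S \<Longrightarrow> k < n \<Longrightarrow> k + g n \<le> n"
    and "\<not> summable (\<lambda>n. if n \<in> S then p n else 0)"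
proof
  define G where "G j = g (2 ^ Suc j)" for j
  have G: "0 < G j" for j using g(2) by (simp add: G_def)
  \<comment> \<open>Starting at \<open>s = 1\<close> rather than 0 leaves a distance
    \<open>G j\<close> to everything up to \<open>2 ^ j\<close>, so points of different blocks are
    separated as well.\<close>
  define S where "S = {2 ^ j + s * G j | j s. 1 \<le> s \<and> s * G j \<le> 2 ^ j}"
  show "0 < k" if "k \<in> S" for k
    using that by (auto simp: S_def)
  show "k + g n \<le> n" if "k \<in> S" "n \<in> S" "k < n" for k n
  proof -
    obtain i t where k: "k = 2 ^ i + t * G i" "1 \<le> t" "t * G i \<le> 2 ^ i"
      using \<open>k \<in> S\<close> by (auto simp: S_def)
    obtain j s where n: "n = 2 ^ j + s * G j" "1 \<le> s" "s * G j \<le> 2 ^ j"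
      using \<open>n \<in> S\<close> by (auto simp: S_def)
    have "g n \<le> G j"
      unfolding G_def using n by (intro monoD[OF g(1)]) simp
    moreover have "k + G j \<le> n"
    proof (cases i j rule: linorder_cases)
      case less
      then have "(2::nat) ^ Suc i \<le> 2 ^ j" by (intro power_increasing) auto
      moreover have "G j \<le> s * G j" using n by simp
      ultimately show ?thesis unfolding k(1) n(1) using k(3) by (simp only: power_Suc)
    next
      case equal
      then have "t * G j < s * G j" using k n \<open>k < n\<close> by simp
      then have "Suc t \<le> s" by simp
      then have "Suc t * G j \<le> s * G j" by (rule mult_le_mono1)
      then show ?thesis using k n equal by simp
    next
      case greater
      then have "(2::nat) ^ Suc j \<le> 2 ^ i" by (intro power_increasing) auto
      then have "n \<le> 2 ^ i" using n by simp
      then show ?thesis using k \<open>k < n\<close> by simp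
    qed
    ultimately show ?thesis by simp
  qed
  show "\<not> summable (\<lambda>n. if n \<in> S then p n else 0)"
  proof
    define f where "f n = (if n \<in> S then p n else 0)" for n
    assume "summable (\<lambda>n. if n \<in> S then p n else 0)"
    then have f: "summable f" by (simp add: f_def[abs_def])
    have f0: "0 \<le> f n" for n using p(2) by (simp add: f_def)
    \<comment> \<open>The half-open blocks tile the integers above 1, so summability over
      \<open>S\<close> passes to the block sums.\<close>
    define b where "b j = (\<Sum>n\<in>{2 ^ j<..2 ^ Suc j}. f n)" for j
    have "(\<Sum>j<J. b j) = (\<Sum>n\<in>{1<..2 ^ J}. f n)" for J
    proof (induction J)
      case (Suc J)
      have "{1<..2 ^ Suc J} = {1<..2 ^ J} \<union> {2 ^ J<..(2 ^ Suc J :: nat)}"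
        by (intro ivl_disj_un_two(6)[symmetric]) auto
      then have "(\<Sum>n\<in>{1<..2 ^ Suc J}. f n) = (\<Sum>n\<in>{1<..2 ^ J}. f n) + b J"
        by (simp only: b_def) (subst sum.union_disjoint, auto)
      then show ?case using Suc by simp
    qed simp
    moreover have "(\<Sum>n\<in>{1<..2 ^ J}. f n) \<le> suminf f" for J
      by (rule sum_le_suminf[OF f]) (auto simp: f0)
    ultimately have "summable b"
      by (intro summableI_nonneg_bounded[where x = "suminf f"])
        (simp_all add: b_def f0 sum_nonneg)
    \<comment> \<open>With \<open>c\<close> the number of selected points,
      \<open>2 ^ j / G j < c + 1 \<le> 2 * c\<close> as soon as \<open>c \<ge> 1\<close>, and each
      of these points has \<open>p\<close> at least the value at the right end of the block.\<close>
    have cmp: "2 ^ j * (p (2 ^ Suc j) / real (G j))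
      \<le> 2 * b j + (if 2 ^ j < g (2 ^ Suc j) then p (2 ^ Suc j) else 0)" for j
    proof (cases "2 ^ j < G j")
      case True
      have "0 \<le> b j" by (simp add: b_def f0 sum_nonneg)
      moreover have "2 ^ j \<le> real (G j)"
        using True by (metis less_imp_le of_nat_le_iff of_nat_numeral of_nat_power)
      then have "2 ^ j * (p (2 ^ Suc j) / real (G j)) \<le> p (2 ^ Suc j)"
        using p(2)[of "2 ^ Suc j"] G[of j] by (simp add: field_simps mult_right_mono del: power_Suc)
      ultimately show ?thesis using True by (simp add: G_def)
    next
      case False
      define c where "c = 2 ^ j div G j"
      have c1: "1 \<le> c" using False G[of j] by (simp add: c_def Suc_le_eq div_greater_zero_iff)
      have c: "c * G j \<le> 2 ^ j" by (simp add: c_def)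
      have "2 ^ j < Suc c * G j"
        unfolding c_def using dividend_less_div_times[OF G[of j], of "2 ^ j"] by simp
      also have "\<dots> \<le> 2 * c * G j" using c1 by simp
      finally have "real (2 ^ j) < real (2 * c * G j)" by (rule of_nat_less_iff[THEN iffD2])
      then have c2: "2 ^ j / real (G j) \<le> 2 * real c"
        using G[of j] by (simp add: field_simps)
      define T where "T = (\<lambda>s. 2 ^ j + s * G j) ` {1..c}"
      have inj: "inj_on (\<lambda>s. 2 ^ j + s * G j) {1..c}" using G[of j] by (auto simp: inj_on_def)
      have sG: "s * G j \<le> 2 ^ j" if "s \<le> c" for s
        by (rule order_trans[OF mult_le_mono1[OF that] c])
      have T: "T \<subseteq> S" "T \<subseteq> {2 ^ j<..2 ^ Suc j}"
        using G[of j] sG by (fastforce simp: T_def S_def)+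
      have "real c * p (2 ^ Suc j) = (\<Sum>n\<in>T. p (2 ^ Suc j))"
        by (simp only: T_def sum_constant card_image[OF inj]) simp
      also have "\<dots> \<le> (\<Sum>n\<in>T. f n)"
      proof (rule sum_mono)
        fix n assume "n \<in> T"
        then have "n \<in> S" "n \<le> 2 ^ Suc j" using T by auto
        then show "p (2 ^ Suc j) \<le> f n"
          using antimonoD[OF p(1), of n "2 ^ Suc j"] by (simp add: f_def)
      qed
      also have "\<dots> \<le> b j"
        unfolding b_def by (rule sum_mono2) (use T f0 in auto)
      finally have "real c * p (2 ^ Suc j) \<le> b j" .
      moreover have "2 ^ j / real (G j) * p (2 ^ Suc j) \<le> 2 * real c * p (2 ^ Suc j)"
        by (rule mult_right_mono[OF c2 p(2)])
      ultimately show ?thesis using False by (simp add: G_def)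
    qed
    have "norm (2 ^ j * (p (2 ^ Suc j) / real (G j)))
      \<le> 2 * b j + (if 2 ^ j < g (2 ^ Suc j) then p (2 ^ Suc j) else 0)" for j
      using cmp[of j] p(2)[of "2 ^ Suc j"] by (subst real_norm_def, subst abs_of_nonneg) simp_all
    then have "summable (\<lambda>j. 2 ^ j * (p (2 ^ Suc j) / real (G j)))"
      by (rule summable_comparison_test'[OF summable_add[OF summable_mult[OF \<open>summable b\<close>] bad]])
    \<comment> \<open>Block \<open>j\<close> was measured at its right end \<open>2 ^ Suc j\<close>;
      one more factor 2 and an index shift give the condensed series of
      \<open>p n / g n\<close>.\<close>
    then have "summable (\<lambda>j. 2 ^ Suc j * (p (2 ^ Suc j) / real (g (2 ^ Suc j))))"
      using summable_mult[of "\<lambda>j. 2 ^ j * (p (2 ^ Suc j) / real (G j))" 2]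
      by (simp only: G_def power_Suc mult.assoc)
    then have "summable (\<lambda>j. 2 ^ j * (p (2 ^ j) / real (g (2 ^ j))))"
      by (subst (asm) summable_Suc_iff)
    moreover have "summable (\<lambda>n. p n / real (g n)) \<longleftrightarrow> summable (\<lambda>j. 2 ^ j * (p (2 ^ j) / real (g (2 ^ j))))"
    proof (rule condensation_test)
      show "p (Suc m) / real (g (Suc m)) \<le> p m / real (g m)" for m
        using antimonoD[OF p(1), of m "Suc m"] p(2) g monoD[OF g(1), of m "Suc m"]
        by (intro frac_le) auto
      show "0 \<le> p n / real (g n)" for n using p(2) by simp
    qed
    ultimately show False using div by blast
  qed
qed

section \<open>Probability of avoiding all events of a sparse set\<close>

text \<open>An error proportional to \<open>p n\<close> is what is needed: \<epsilon> is then the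
  fixed point of \<open>x \<mapsto> (1 - p n) * x + \<epsilon> * p n\<close>, so the mixing errors
  do not accumulate with the number of steps.\<close>

lemma (in prob_space) avoidance_prob_le:
  fixes X :: "int \<Rightarrow> 'a \<Rightarrow> 'e::topological_space" and A :: "nat \<Rightarrow> 'e set"
  defines "p \<equiv> \<lambda>n. prob {\<omega> \<in> space M. X (int n) \<omega> \<in> A n}"
  assumes st: "strictly_stationary M X"
    and A: "\<And>k. k \<in> S \<Longrightarrow> A k \<in> sets borel"
    and gap: "\<And>k n. k \<in> S \<Longrightarrow> n \<in> S \<Longrightarrow> k < n \<Longrightarrow> k + g n \<le> n"
    and mix: "\<And>n. n \<in> S \<Longrightarrow> alpha_inf_1 M X (g n) \<le> \<epsilon> * p n"
    and \<epsilon>: "0 \<le> \<epsilon>"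
  shows "prob {\<omega> \<in> space M. \<forall>k\<in>S \<inter> {..<n}. X (int k) \<omega> \<notin> A k} \<le> \<epsilon> + exp (- (\<Sum>k<n. if k \<in> S then p k else 0))"
proof (induction n)
  case 0
  show ?case using \<epsilon> prob_le_1 by (simp add: add_increasing)
next
  case (Suc n)
  define D where "D = {\<omega> \<in> space M. \<forall>k\<in>S \<inter> {..<n}. X (int k) \<omega> \<notin> A k}"
  define s where "s = (\<Sum>k<n. if k \<in> S then p k else 0)"
  have IH: "prob D \<le> \<epsilon> + exp (- s)" using Suc by (simp add: D_def s_def)
  show ?case
  proof (cases "n \<in> S")
    case False
    then have "S \<inter> {..<Suc n} = S \<inter> {..<n}" by (auto simp: less_Suc_eq)
    with IH False show ?thesis by (simp add: D_def s_def)
  next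
    case True
    define E where "E = {\<omega> \<in> space M. X (int n) \<omega> \<in> A n}"
    have X: "X i \<in> measurable M borel" for i
      using st by (auto simp: strictly_stationary_def)
    have "{\<omega> \<in> space M. X (int k) \<omega> \<in> A k} \<in> events" if "k \<in> S" for k
      using A[OF that] X by measurable
    then have meas: "D \<in> events" "E \<in> events"
      using True unfolding D_def E_def
      by (auto intro!: sets.sets_Collect_finite_All sets.sets_Collect_neg)
    have "\<bar>prob {\<omega> \<in> space M. (\<forall>l\<in>int ` (S \<inter> {..<n}). X l \<omega> \<in> - A (nat l)) \<and> X (int n) \<omega> \<in> A n} -
      prob {\<omega> \<in> space M. \<forall>l\<in>int ` (S \<inter> {..<n}). X l \<omega> \<in> - A (nat l)} * prob E\<bar> \<le> alpha_inf_1 M X (g n)"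
      unfolding E_def
    proof (rule alpha_inf_1_past_future[OF st])
      fix l assume "l \<in> int ` (S \<inter> {..<n})"
      then obtain k where k: "l = int k" "k \<in> S" "k < n" by auto
      then show "l + int (g n) \<le> int n" "- A (nat l) \<in> sets borel"
        using gap[of k n] True A[of k] by auto
    qed (use A True in auto)
    then have "\<bar>prob (D \<inter> E) - prob D * p n\<bar> \<le> alpha_inf_1 M X (g n)"
      by (simp add: D_def E_def p_def Int_def conj_ac cong: conj_cong)
    with mix[OF True] have "prob D * p n - prob (D \<inter> E) \<le> \<epsilon> * p n" by linarith
    moreover have "prob (D - E) = prob D - prob (D \<inter> E)"
      using meas by (simp add: finite_measure_Diff')
    ultimately have "prob (D - E) - \<epsilon> \<le> (1 - p n) * (prob D - \<epsilon>)"
      by (simp add: algebra_simps)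
    also have "\<dots> \<le> (1 - p n) * exp (- s)"
      using IH prob_le_1 by (intro mult_left_mono) (auto simp: p_def)
    also have "\<dots> \<le> exp (- p n) * exp (- s)"
      using exp_ge_add_one_self[of "- p n"] by (intro mult_right_mono) auto
    also have "\<dots> = exp (- (s + p n))" by (simp add: exp_add[symmetric])
    finally have "prob (D - E) \<le> \<epsilon> + exp (- (s + p n))" by simp
    moreover have "{\<omega> \<in> space M. \<forall>k\<in>S \<inter> {..<Suc n}. X (int k) \<omega> \<notin> A k} = D - E"
      using True by (auto simp: D_def E_def less_Suc_eq)
    ultimately show ?thesis using True by (simp add: s_def)
  qed
qed

section \<open>Construction of the gaps from the doubling condition\<close>

text \<open>The auxiliary \<open>h n\<close> is the inverse of \<open>v\<close> at
  \<open>p n\<close>, with the search started at \<open>n0\<close>, where doubling becomes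
  available. Finitely many doublings of \<open>h n\<close> then gain the factor \<epsilon>, at the
  price of a constant factor in the series.\<close>

lemma mixing_gap_function:
  fixes p v :: "nat \<Rightarrow> real"
  assumes p: "antimono p" "\<And>n. 0 < p n" "\<not> summable p"
    and v: "antimono v" "\<And>n. n0 \<le> n \<Longrightarrow> 0 \<le> v n"
    and "0 < n0" "0 < \<delta>" "0 < \<epsilon>"
    and dbl: "\<And>n. n0 \<le> n \<Longrightarrow> v (2 * n) \<le> (1 - \<delta>) * v n"
    and div: "\<And>N. 1 \<le> N \<Longrightarrow> (\<Sum>n. ereal (p (N + n)) / seq_inverse v (p (N + n))) = \<infinity>"
  obtains g where "mono g" "\<And>n. n0 \<le> g n" "\<And>n. v (g n) \<le> \<epsilon> * p n"
    "summable (\<lambda>j. if 2 ^ j < g (2 ^ Suc j) then p (2 ^ Suc j) else 0)"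
    "\<not> summable (\<lambda>n. p n / real (g n))"
proof -
  \<comment> \<open>Truncation at 0 covers \<open>\<delta> > 1\<close>: powers and products of
    inequalities need a nonnegative ratio.\<close>
  define r where "r = max (1 - \<delta>) 0"
  have r: "0 \<le> r" "r < 1" using \<open>0 < \<delta>\<close> by (auto simp: r_def)
  have pow: "v (2 ^ q * n) \<le> r ^ q * v n" if n: "n0 \<le> n" for q n
  proof (induction q)
    case (Suc q)
    have "n0 \<le> 2 ^ q * n" using order_trans[OF n, of "2 ^ q * n"] by simp
    then have "v (2 * (2 ^ q * n)) \<le> r * v (2 ^ q * n)"
      using dbl[of "2 ^ q * n"] v(2)[of "2 ^ q * n"]
        mult_right_mono[of "1 - \<delta>" r "v (2 ^ q * n)"] by (auto simp: r_def)
    also have "\<dots> \<le> r * (r ^ q * v n)" by (rule mult_left_mono[OF Suc r(1)])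
    finally show ?case by (simp add: mult.assoc)
  qed simp
  have ev: "\<exists>q. r ^ q * c \<le> e" if "0 < e" for c e :: real
  proof -
    have "(\<lambda>q. r ^ q * c) \<longlonglongrightarrow> 0 * c" using r by (intro tendsto_intros) auto
    then have "eventually (\<lambda>q. r ^ q * c < e) sequentially" using that by (intro order_tendstoD) auto
    then show ?thesis by (auto simp: eventually_sequentially intro: less_imp_le)
  qed
  define h where "h n = (LEAST m. n0 \<le> m \<and> v m \<le> p n)" for n
  have h: "n0 \<le> h n \<and> v (h n) \<le> p n" for n
  proof -
    obtain q where "r ^ q * v n0 \<le> p n" using ev[OF p(2)] by blast
    then have "n0 \<le> 2 ^ q * n0 \<and> v (2 ^ q * n0) \<le> p n" using pow[of n0 q] by simp
    then show ?thesis unfolding h_def by (rule LeastI)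
  qed
  have h_le: "h n \<le> m" if "n0 \<le> m" "v m \<le> p n" for m n
    unfolding h_def using that by (intro Least_le) auto
  obtain q where q: "r ^ q \<le> \<epsilon>" using ev[OF \<open>0 < \<epsilon>\<close>, of 1] by auto
  define g where "g n = 2 ^ q * h n" for n
  show thesis
  proof (rule that)
    show "mono g"
    proof
      fix m n :: nat assume "m \<le> n"
      then have "v (h n) \<le> p m" using h[of n] antimonoD[OF p(1), of m n] by linarith
      then show "g m \<le> g n" using h[of n] by (auto simp: g_def intro: h_le)
    qed
    show "n0 \<le> g n" for n
      using h[of n] order_trans[of n0 "h n" "g n"] by (simp add: g_def)
    show "v (g n) \<le> \<epsilon> * p n" for n
    proof -
      have "v (g n) \<le> r ^ q * v (h n)" unfolding g_def using h by (intro pow) auto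
      also have "\<dots> \<le> \<epsilon> * p n" using q h[of n] v(2) r \<open>0 < \<epsilon>\<close> by (intro mult_mono) auto
      finally show ?thesis .
    qed
    show "summable (\<lambda>j. if 2 ^ j < g (2 ^ Suc j) then p (2 ^ Suc j) else 0)" (is "summable ?f")
    proof -
      \<comment> \<open>Dividing by \<open>2 ^ q\<close> shows that \<open>2 ^ (j + n0)\<close> lies
        below \<open>h\<close>; being at least \<open>n0\<close>, it must fail the defining
        condition of \<open>h\<close>, so \<open>p\<close> is smaller than \<open>v\<close> there.
        Dropping the first \<open>q + n0\<close> blocks makes the doubling bound from
        \<open>2 ^ n0\<close> applicable.\<close>
      have le: "?f (j + (q + n0)) \<le> r ^ j * v (2 ^ n0)" for j
      proof (cases "2 ^ (j + (q + n0)) < g (2 ^ Suc (j + (q + n0)))")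
        case True
        have "(2::nat) ^ (j + (q + n0)) = 2 ^ q * 2 ^ (j + n0)" by (simp add: power_add)
        with True have "2 ^ (j + n0) < h (2 ^ Suc (j + (q + n0)))" by (simp add: g_def)
        moreover have "n0 \<le> 2 ^ n0" by (rule less_imp_le) (rule less_exp)
        moreover have "(2::nat) ^ n0 \<le> 2 ^ (j + n0)" by (rule power_increasing) auto
        ultimately have "p (2 ^ Suc (j + (q + n0))) < v (2 ^ (j + n0))"
          using h_le[of "2 ^ (j + n0)" "2 ^ Suc (j + (q + n0))"] by linarith
        also have "\<dots> \<le> r ^ j * v (2 ^ n0)"
          using pow[OF \<open>n0 \<le> 2 ^ n0\<close>, of j] by (simp add: power_add)
        finally show ?thesis by (simp add: True del: power_Suc)
      next
        case False
        then show ?thesis using r v(2)[of "2 ^ n0"] less_imp_le[OF less_exp[of n0]] by simp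
      qed
      have pos: "0 \<le> ?f j" for j using p(2) by (simp add: less_imp_le)
      have "summable (\<lambda>j. r ^ j * v (2 ^ n0))"
        using r by (intro summable_mult2 summable_geometric) auto
      then have "summable (\<lambda>j. ?f (j + (q + n0)))"
      proof (rule summable_comparison_test')
        show "norm (?f (j + (q + n0))) \<le> r ^ j * v (2 ^ n0)" for j
          unfolding real_norm_def abs_of_nonneg[OF pos] by (rule le)
      qed
      then show ?thesis by (rule summable_iff_shift[THEN iffD1])
    qed
    show "\<not> summable (\<lambda>n. p n / real (g n))"
    proof
      assume "summable (\<lambda>n. p n / real (g n))"
      then have "summable (\<lambda>n. 2 ^ q * (p n / real (g n)))" by (rule summable_mult)
      then have ph: "summable (\<lambda>n. p n / real (h n))" by (simp add: g_def)
      \<comment> \<open>If \<open>p\<close> never drops below \<open>v n0\<close>, the true inverse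
        may be smaller than \<open>n0\<close>, even 0; but then \<open>h\<close> is constant and
        divergence of the sum of \<open>p\<close> suffices.\<close>
      show False
      proof (cases "\<forall>n. v n0 \<le> p n")
        case True
        then have "h n = n0" for n using h[of n] h_le[of n0 n] by (simp add: antisym)
        with ph p(3) \<open>0 < n0\<close> show False by (simp add: summable_divide_iff)
      next
        case False
        then obtain N where "p N < v n0" by (auto simp: not_le)
        then have N: "p n < v n0" if "N \<le> n" for n
          using antimonoD[OF p(1) that] by linarith
        \<comment> \<open>Once \<open>p n < v n0\<close>, monotonicity of \<open>v\<close> forces
          every candidate index to be at least \<open>n0\<close>, so starting the search there
          changes nothing.\<close>
        have inv: "seq_inverse v (p n) = ereal (real (h n))" if "N \<le> n" for n
          unfolding seq_inverse_def
        proof (rule INF_eqI)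
          fix m assume "m \<in> {m. v m \<le> p n}"
          then have "v m \<le> p n" by simp
          moreover from this have "n0 \<le> m"
            using N[OF that] antimonoD[OF v(1), of m n0] by linarith
          ultimately show "ereal (real (h n)) \<le> ereal (real m)" using h_le by simp
        qed (use h in blast)
        define w where "w n = p (Suc N + n) / real (h (Suc N + n))" for n
        have h0: "0 < h n" for n using h[of n] \<open>0 < n0\<close> by linarith
        have "summable w"
          using summable_iff_shift[of "\<lambda>n. p n / real (h n)" "Suc N"] ph
          by (simp add: w_def[abs_def] add.commute)
        then have "(\<Sum>n. ereal (w n)) \<noteq> \<infinity>"
          using p(2) by (subst suminf_ereal') (auto simp: w_def less_imp_le)
        moreover have "ereal (p (Suc N + n)) / seq_inverse v (p (Suc N + n)) = ereal (w n)" for n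
          using h0[of "Suc N + n"] by (subst inv) (auto simp: w_def)
        ultimately show False using div[of "Suc N"] by simp
      qed
    qed
  qed
qed

section \<open>Assembly of the Borel-Cantelli property\<close>

theorem theorem3p2:
  fixes M :: "'w measure"
    and X :: "int \<Rightarrow> 'w \<Rightarrow> 'e::polish_space"
    and \<mu> :: "'e measure"
    and A :: "nat \<Rightarrow> 'e set"
    and B :: "nat \<Rightarrow> 'w set"
    and \<alpha>s :: "nat \<Rightarrow> real"
    and n0 :: nat and C \<delta> :: real
  assumes "prob_space M"
    and "strictly_stationary M X"
    and "\<mu> = distr M borel (X 0)"
    and "\<And>k. k > 0 \<Longrightarrow> A k \<in> sets borel"
    and "(\<Sum>k. ereal (measure \<mu> (A (Suc k)))) = \<infinity>"
    and "\<And>k. k > 0 \<Longrightarrow> B k = {\<omega> \<in> space M. X (int k) \<omega> \<in> A k}"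
    and "n0 > 0" and "C > 0" and "\<delta> > 0"
    and "antimono \<alpha>s"
    and "\<And>n. n \<ge> n0 \<Longrightarrow> alpha_inf_1 M X n \<le> C * \<alpha>s n"
    and "\<And>n. n \<ge> n0 \<Longrightarrow> \<alpha>s (2 * n) \<le> (1 - \<delta>) * \<alpha>s n"
    and "antimono_on {1..} (\<lambda>n. measure \<mu> (A n))"
    and "(\<lambda>n. ereal (measure \<mu> (A n)) / ereal (\<alpha>s n)) \<longlonglongrightarrow> \<infinity>"
    and "\<And>N. N \<ge> 1 \<Longrightarrow>
           (\<Sum>n. ereal (measure \<mu> (A (N + n))) / seq_inverse \<alpha>s (measure \<mu> (A (N + n)))) = \<infinity>"
  shows "borel_cantelli_seq M B"
proof -
  interpret prob_space M by fact
  note st = assms(2) and A = assms(4) and B = assms(6)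
  have X[measurable]: "X i \<in> measurable M borel" for i
    using st by (auto simp: strictly_stationary_def)
  \<comment> \<open>Repeating \<open>A 1\<close> at index 0 makes the probabilities monotone on all
    of the naturals.\<close>
  define A' where "A' n = A (max 1 n)" for n
  have A'[measurable]: "A' n \<in> sets borel" for n using A by (simp add: A'_def)
  define p where "p n = measure \<mu> (A' n)" for n
  have p_eq: "p n = prob {\<omega> \<in> space M. X (int n) \<omega> \<in> A' n}" for n
  proof -
    have "{x. x 0 \<in> A' n} \<in> sets (\<Pi>\<^sub>M i\<in>(UNIV::int set). (borel :: 'e measure))"
      using measurable_sets[OF measurable_component_singleton[of "0::int" UNIV "\<lambda>_. borel"] A'[of n]]
      by (simp add: vimage_def space_PiM)
    from strictly_stationary_measure_shift[OF st this, of "int n"] show ?thesis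
      unfolding p_def assms(3) by (simp add: measure_distr vimage_def Int_def conj_commute)
  qed
  have p_anti: "antimono p"
    unfolding p_def A'_def by (intro antimonoI monotone_onD[OF assms(13)]) auto
  have p_div: "\<not> summable p"
  proof
    assume "summable p"
    then have "summable (\<lambda>k. p (Suc k))" by (simp add: summable_Suc_iff)
    then have "(\<Sum>k. ereal (p (Suc k))) \<noteq> \<infinity>"
      by (subst suminf_ereal') (auto simp: p_def)
    with assms(5) show False by (simp add: p_def A'_def)
  qed
  have p_pos: "0 < p n" for n
  proof (rule ccontr)
    assume "\<not> 0 < p n"
    then have "p m = 0" if "n \<le> m" for m
      using antimonoD[OF p_anti that] by (simp add: p_def measure_le_0_iff not_less)
    then have "summable p" by (intro summable_finite[of "{..<n}"]) auto
    with p_div show False ..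
  qed
  \<comment> \<open>The pair of empty events has discrepancy 0, so the mixing coefficient, and with
    it \<open>\<alpha>s\<close> from \<open>n0\<close> on, is nonnegative.\<close>
  have \<alpha>s_nonneg: "0 \<le> \<alpha>s n" if "n0 \<le> n" for n
  proof -
    have "{} \<in> sigma_gen M X I" for I by (simp add: sigma_gen_def sigma_sets.Empty)
    then have "0 \<le> alpha_inf_1 M X n"
      using alpha_coeff_upper[of "{}" "sigma_gen M X {..- int n}" "{}" "sigma_gen M X {0}"]
      by (simp add: alpha_inf_1_def)
    then have "0 \<le> C * \<alpha>s n" using assms(11)[OF that] by linarith
    with \<open>C > 0\<close> show ?thesis by (simp add: zero_le_mult_iff)
  qed
  have Bm: "B k \<in> events" if "0 < k" for k
    unfolding B[OF that] using A[OF that] by measurable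
  define W where "W N = {\<omega> \<in> space M. \<forall>k>N. \<omega> \<notin> B k}" for N
  have W: "W N \<in> events" for N
  proof -
    have "W N = space M - (\<Union>k\<in>{N<..}. B k)" by (auto simp: W_def)
    also have "\<dots> \<in> events" using Bm by (intro sets.Diff sets.countable_UN'') auto
    finally show ?thesis .
  qed
  have W_le: "prob (W N) \<le> 2 * \<epsilon>" if "0 < \<epsilon>" for N \<epsilon>
  proof -
    \<comment> \<open>Level \<open>\<epsilon> / C\<close> compensates the constant in
      \<open>alpha_inf_1 M X n \<le> C * \<alpha>s n\<close>. One \<epsilon> of the final bound is
      the mixing error, the other bounds the exponential.\<close>
    have \<epsilon>: "0 < \<epsilon> / C" using that \<open>C > 0\<close> by simp
    have div: "(\<Sum>n. ereal (p (K + n)) / seq_inverse \<alpha>s (p (K + n))) = \<infinity>" if "1 \<le> K" for K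
      using assms(15)[OF that] that by (simp add: p_def A'_def max_def)
    obtain g where g: "mono g" "\<And>n. n0 \<le> g n" "\<And>n. \<alpha>s (g n) \<le> \<epsilon> / C * p n"
      "summable (\<lambda>j. if 2 ^ j < g (2 ^ Suc j) then p (2 ^ Suc j) else 0)"
      "\<not> summable (\<lambda>n. p n / real (g n))"
      by (rule mixing_gap_function[OF p_anti p_pos p_div assms(10) \<alpha>s_nonneg assms(7,9) \<epsilon> assms(12) div]) (assumption | rule that)+
    have g_pos: "0 < g n" for n using g(2)[of n] \<open>n0 > 0\<close> by linarith
    obtain S where S: "\<And>k. k \<in> S \<Longrightarrow> 0 < k"
      "\<And>k n. k \<in> S \<Longrightarrow> n \<in> S \<Longrightarrow> k < n \<Longrightarrow> k + g n \<le> n"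
      "\<not> summable (\<lambda>n. if n \<in> S then p n else 0)"
      by (rule sparse_index_set[OF p_anti less_imp_le[OF p_pos] g(1) g_pos g(4,5)]) (assumption | rule that)+
    \<comment> \<open>Discarding the indices up to \<open>N\<close> preserves both the gaps and the
      divergence, so the bound applies to every tail.\<close>
    define T where "T = S \<inter> {N<..}"
    define s where "s n = (\<Sum>k<n. if k \<in> T then p k else 0)" for n
    have "\<exists>n. - ln \<epsilon> < s n"
    proof (rule ccontr)
      assume "\<nexists>n. - ln \<epsilon> < s n"
      then have "summable (\<lambda>n. if n \<in> T then p n else 0)"
        by (intro summableI_nonneg_bounded[of _ "- ln \<epsilon>"])
          (auto simp: s_def not_less less_imp_le[OF p_pos])
      moreover have ev: "eventually (\<lambda>n. (if n \<in> T then p n else 0) = (if n \<in> S then p n else 0)) sequentially"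
        using eventually_gt_at_top[of N] by eventually_elim (simp add: T_def)
      ultimately show False using S(3) by (simp only: summable_cong[OF ev])
    qed
    then obtain n where n: "- ln \<epsilon> < s n" ..
    have "prob {\<omega> \<in> space M. \<forall>k\<in>T \<inter> {..<n}. X (int k) \<omega> \<notin> A' k} \<le> \<epsilon> + exp (- s n)"
      unfolding s_def p_eq
    proof (rule avoidance_prob_le[OF st A'])
      show "k + g n \<le> n" if "k \<in> T" "n \<in> T" "k < n" for k n
        using S(2) that by (auto simp: T_def)
      show "alpha_inf_1 M X (g n) \<le> \<epsilon> * prob {\<omega> \<in> space M. X (int n) \<omega> \<in> A' n}" for n
        using assms(11)[OF g(2)[of n]] mult_left_mono[OF g(3)[of n], of C] \<open>C > 0\<close>
        by (simp add: p_eq[symmetric])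
    qed (use that in simp)
    moreover have "prob (W N) \<le> prob {\<omega> \<in> space M. \<forall>k\<in>T \<inter> {..<n}. X (int k) \<omega> \<notin> A' k}"
    proof (rule finite_measure_mono)
      show "W N \<subseteq> {\<omega> \<in> space M. \<forall>k\<in>T \<inter> {..<n}. X (int k) \<omega> \<notin> A' k}"
        by (auto simp: W_def T_def B A'_def max_def)
      have "{\<omega> \<in> space M. X (int k) \<omega> \<notin> A' k} \<in> events" for k by measurable
      then show "{\<omega> \<in> space M. \<forall>k\<in>T \<inter> {..<n}. X (int k) \<omega> \<notin> A' k} \<in> events"
        by (intro sets.sets_Collect_finite_All) auto
    qed
    moreover have "exp (- s n) \<le> \<epsilon>"
      using n that exp_le_cancel_iff[of "- s n" "ln \<epsilon>"] by simp
    ultimately show ?thesis by linarith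
  qed
  have "prob (W N) \<le> 0" for N
    by (rule field_le_epsilon) (use W_le[of "e / 2" for e] in simp)
  then have "prob (W N) = 0" for N by (simp add: measure_le_0_iff)
  then have AE_W: "AE \<omega> in M. \<forall>N. \<omega> \<notin> W N"
    using W by (simp add: AE_all_countable prob_eq_0)
  \<comment> \<open>Tails with strict inequality never contain index 0, where \<open>B\<close> is
    unconstrained and might not be measurable.\<close>
  have limsup: "limsup B = (\<Inter>m. \<Union>n\<in>{m<..}. B n)"
    unfolding limsup_INF_SUP
  proof (intro antisym INF_greatest)
    show "(\<Inter>m. \<Union>n\<in>{m..}. B n) \<subseteq> (\<Union>n\<in>{m<..}. B n)" for m
      by (rule INF_lower2[of "Suc m"]) (auto simp: atLeast_Suc_greaterThan)
    show "(\<Inter>m. \<Union>n\<in>{m<..}. B n) \<subseteq> (\<Union>n\<in>{m..}. B n)" for m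
      by (rule INF_lower2[of m]) (auto intro: less_imp_le)
  qed
  have "limsup B \<in> events"
    unfolding limsup using Bm by (intro sets.countable_INT) (auto intro!: sets.countable_UN'')
  moreover have "AE \<omega> in M. \<omega> \<in> limsup B"
    using AE_W AE_space
    by eventually_elim (auto simp: limsup W_def)
  ultimately show ?thesis
    unfolding borel_cantelli_seq_def by (simp add: prob_eq_1)
qed

end
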